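(* Let $n$ and $d$ be positive integers with $d\le n$. For real $x$ let $\lceil x\rceil^{+}$ denote the smallest nonnegative integer $m$ with $m\ge x$. Put $$L_{i,j}=\sum_{k=\lceil\frac{i+j-d+1}{2}\rceil^{+}}^{\min(i,j)}\ \sum_{l=0}^{\min\{d+2k-i-j-1,\,k\}}\binom{i}{k}\binom{n-i}{j-k}\binom{k}{l}(l+j-k)!$$ and $$E(n,d-1)=\frac{1}{6}\sum_{i=2}^{d-1}\sum_{j=2}^{d-1}\binom{n}{i}D_i\,L_{i,j}.$$ Then $$P(n,d)\ \ge\ \frac{n!}{10\,V(n,d-1)}\left(\log_2 V(n,d-1)-\tfrac12\log_2 E(n,d-1)\right).$$
   Context: $S_n$ is the group of permutations of $Z_n=\{0,1,\ldots,n-1\}$. The Hamming distance $d(\mathbf{x},\mathbf{y})$ of $\mathbf{x},\mathbf{y}\in S_n$ is the number of $i\in Z_n$ with $\mathbf{x}(i)\neq\mathbf{y}(i)$. An $(n,d)$ permutation array (PA) is a subset $C\subseteq S_n$ in which any two distinct elements have distance at least $d$; $P(n,d)$ is the maximum size of an $(n,d)$ PA. $D_k$ is the number of derangements (permutations without fixed points) of $k$ elements, with $D_0=1$. $V(n,d-1)=\sum_{i=0}^{d-1}\binom{n}{i}D_i$. Binomial coefficients $\binom{a}{b}$ with $b>a\ge 0$ are $0$, and empty sums are $0$. *)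

theory Defs
  imports Complex_Main "HOL-Combinatorics.Permutations"
begin

definition sym_grp :: "nat \<Rightarrow> (nat \<Rightarrow> nat) set" where
  "sym_grp n = {x. x permutes {..<n}}"

definition hamming :: "nat \<Rightarrow> (nat \<Rightarrow> nat) \<Rightarrow> (nat \<Rightarrow> nat) \<Rightarrow> nat" where
  "hamming n x y = card {i \<in> {..<n}. x i \<noteq> y i}"

definition perm_array :: "nat \<Rightarrow> nat \<Rightarrow> (nat \<Rightarrow> nat) set \<Rightarrow> bool" where
  "perm_array n d C \<longleftrightarrow>
     C \<subseteq> sym_grp n \<and> (\<forall>x\<in>C. \<forall>y\<in>C. x \<noteq> y \<longrightarrow> d \<le> hamming n x y)"

definition P :: "nat \<Rightarrow> nat \<Rightarrow> nat" where
  "P n d = Max (card ` {C. perm_array n d C})"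

lemma finite_sym_grp: "finite (sym_grp n)"
  unfolding sym_grp_def by (rule finite_permutations) simp

(* The maximum in the definition of P is over a nonempty finite set. *)
lemma finite_perm_arrays: "finite {C. perm_array n d C}"
  by (rule finite_subset[of _ "Pow (sym_grp n)"])
     (auto simp: perm_array_def finite_sym_grp)

lemma perm_arrays_nonempty: "{C. perm_array n d C} \<noteq> {}"
proof -
  have "perm_array n d {}" by (simp add: perm_array_def)
  then show ?thesis by blast
qed

definition derangements :: "nat \<Rightarrow> nat" where
  "derangements k = card {p \<in> sym_grp k. \<forall>i<k. p i \<noteq> i}"

lemma derangements_0: "derangements 0 = 1"
  by (simp add: derangements_def sym_grp_def)

definition V :: "nat \<Rightarrow> nat \<Rightarrow> nat" where
  "V n r = (\<Sum>i=0..r. (n choose i) * derangements i)"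

definition ceil_plus :: "real \<Rightarrow> nat" where
  "ceil_plus x = (LEAST m. x \<le> real m)"

lemma ceil_plus_eq: "ceil_plus x = nat \<lceil>x\<rceil>"
  unfolding ceil_plus_def by (rule Least_equality) linarith+

(* The upper limit for l is an integer, so that the inner sum is empty
   if that limit is negative. *)
definition L :: "nat \<Rightarrow> nat \<Rightarrow> nat \<Rightarrow> nat \<Rightarrow> nat" where
  "L n d i j =
     (\<Sum>k = ceil_plus ((real i + real j - real d + 1) / 2) .. min i j.
        \<Sum>l | int l \<le> min (int d + 2 * int k - int i - int j - 1) (int k).
          (i choose k) * ((n - i) choose (j - k)) * (k choose l) * fact (l + j - k))"

(* E n d is the quantity E(n, d - 1): the second argument is the distance d,
   which L also depends on, and not the radius d - 1. *)
definition E :: "nat \<Rightarrow> nat \<Rightarrow> real" where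
  "E n d = 1 / 6 *
     (\<Sum>i = 2..d - 1. \<Sum>j = 2..d - 1.
        real (n choose i) * real (derangements i) * real (L n d i j))"

end

theory Submission imports Defs "HOL-Analysis.Harmonic_Numbers" begin

text \<open>Permutation arrays are the independent sets of the graph on \<open>S\<^sub>n\<close> in which distinct
  permutations at distance less than \<open>d\<close> are adjacent. Its closed neighbourhoods have size at
  most \<open>V = V(n, d - 1)\<close>, and left translations show that every neighbourhood spans at most
  \<open>6 E\<close> ordered adjacent pairs, where \<open>E = E(n, d - 1)\<close>. Let \<open>M = 2 log\<^sub>2 V - log\<^sub>2 E\<close>. If
  \<open>M < 20\<close>, a maximum independent set suffices. Otherwise pick a random independent set \<open>I\<close> with
  probability proportional to \<open>\<mu>\<^bsup>card I\<^esup>\<close>, where \<open>\<mu> = 1 / sqrt (12 E)\<close>. Condition on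
  \<open>I\<close> outside the closed neighbourhood of a vertex \<open>v\<close>, and let \<open>X\<close> be the set of neighbours
  of \<open>v\<close> that are still available. If \<open>X\<close> is small, then \<open>v \<in> I\<close> is likely; if \<open>X\<close> is
  large, then, as \<open>X\<close> spans few edges, \<open>I\<close> contains many points of \<open>X\<close>. Either way
  \<open>V\<close> times the probability of \<open>v \<in> I\<close> plus the expected number of neighbours of \<open>v\<close> in
  \<open>I\<close> is at least \<open>M / 10\<close>, and summing over \<open>v\<close> gives an independent set of size at
  least \<open>n! M / (20 V)\<close>.\<close>

section \<open>Independent sets in locally sparse graphs\<close>

lemma sum_UN_le:
  fixes f :: "'b \<Rightarrow> real"
  assumes "finite I" "\<And>i. i \<in> I \<Longrightarrow> finite (A i)" "\<And>x. f x \<ge> 0"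
  shows "sum f (\<Union>i\<in>I. A i) \<le> (\<Sum>i\<in>I. sum f (A i))"
  using assms(1,2)
proof (induction I rule: finite_induct)
  case (insert i I)
  have "sum f (A i \<union> (\<Union>i\<in>I. A i)) \<le> sum f (A i) + sum f (\<Union>i\<in>I. A i)"
    using insert assms(3) by (subst sum_Un) (auto intro!: sum_nonneg)
  also have "\<dots> \<le> sum f (A i) + (\<Sum>i\<in>I. sum f (A i))"
    using insert by simp
  finally show ?case using insert by simp
qed simp

section \<open>Weighted counts of independent sets (the hard-core model)\<close>

locale simple_graph =
  fixes adj :: "'a \<Rightarrow> 'a \<Rightarrow> bool"
  assumes adj_sym: "adj x y \<Longrightarrow> adj y x" and adj_irrefl: "\<not> adj x x"
begin

definition indep :: "'a set \<Rightarrow> 'a set set" where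
  "indep X = {A. A \<subseteq> X \<and> (\<forall>x\<in>A. \<forall>y\<in>A. \<not> adj x y)}"

definition nbhd :: "'a set \<Rightarrow> 'a \<Rightarrow> 'a set" where
  "nbhd S v = {u \<in> S. adj v u}"

text \<open>The partition function of the hard-core model on \<open>X\<close> at fugacity
  \<open>\<mu>\<close>: the normalising constant of the random independent set.\<close>

definition partition_fn :: "real \<Rightarrow> 'a set \<Rightarrow> real" where
  "partition_fn \<mu> X = (\<Sum>A\<in>indep X. \<mu> ^ card A)"

text \<open>Divided by \<open>partition_fn \<mu> X\<close>, this is the expected size of the random
  independent set of \<open>X\<close>.\<close>

definition size_sum :: "real \<Rightarrow> 'a set \<Rightarrow> real" where
  "size_sum \<mu> X = (\<Sum>A\<in>indep X. \<mu> ^ card A * real (card A))"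

lemma finite_indep: "finite X \<Longrightarrow> finite (indep X)"
  by (rule finite_subset[of _ "Pow X"]) (auto simp: indep_def)

lemma finite_nbhd: "finite S \<Longrightarrow> finite (nbhd S v)"
  by (simp add: nbhd_def)

lemma empty_in_indep: "{} \<in> indep X"
  by (simp add: indep_def)

lemma indep_finite: "finite X \<Longrightarrow> A \<in> indep X \<Longrightarrow> finite A"
  by (auto simp: indep_def dest: finite_subset)

lemma partition_fn_ge_1:
  assumes "finite X" "\<mu> \<ge> 0"
  shows "partition_fn \<mu> X \<ge> 1"
proof -
  have "(\<Sum>A\<in>{{} :: 'a set}. \<mu> ^ card A) \<le> (\<Sum>A\<in>indep X. \<mu> ^ card A)"
    using assms by (intro sum_mono2 finite_indep) (auto simp: empty_in_indep)
  then show ?thesis by (simp add: partition_fn_def)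
qed

text \<open>Dropping independence, the sum over all subsets of \<open>X\<close> is
  \<open>(1 + \<mu>) ^ card X\<close>.\<close>

lemma partition_fn_le_exp:
  assumes "finite X" "\<mu> \<ge> 0"
  shows "partition_fn \<mu> X \<le> exp (\<mu> * real (card X))"
proof -
  have "partition_fn \<mu> X \<le> (\<Sum>A\<in>Pow X. \<mu> ^ card A)"
    unfolding partition_fn_def using assms
    by (intro sum_mono2) (auto simp: indep_def)
  also have "\<dots> = (\<Prod>x\<in>X. \<mu> + 1)"
    using assms(1) by (subst prod_add) simp_all
  also have "\<dots> = (1 + \<mu>) ^ card X" by (simp add: add.commute)
  also have "\<dots> \<le> exp \<mu> ^ card X"
    using assms by (intro power_mono exp_ge_add_one_self) auto
  also have "\<dots> = exp (\<mu> * real (card X))"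
    by (simp add: exp_of_nat2_mult)
  finally show ?thesis .
qed

lemma size_sum_eq:
  assumes "finite X"
  shows "size_sum \<mu> X = (\<Sum>u\<in>X. \<Sum>A | A \<in> indep X \<and> u \<in> A. \<mu> ^ card A)"
proof -
  have "size_sum \<mu> X = (\<Sum>A\<in>indep X. \<Sum>u | u \<in> X \<and> u \<in> A. \<mu> ^ card A)"
    unfolding size_sum_def
  proof (rule sum.cong[OF refl])
    fix A assume "A \<in> indep X"
    then have "{u. u \<in> X \<and> u \<in> A} = A" by (auto simp: indep_def)
    then show "\<mu> ^ card A * real (card A) = (\<Sum>u | u \<in> X \<and> u \<in> A. \<mu> ^ card A)" by simp
  qed
  also have "\<dots> = (\<Sum>u\<in>X. \<Sum>A | A \<in> indep X \<and> u \<in> A. \<mu> ^ card A)"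
    by (rule sum.swap_restrict[OF finite_indep[OF assms] assms])
  finally show ?thesis .
qed

text \<open>Deleting \<open>u\<close> is a bijection onto the independent sets to which
  \<open>u\<close> can be added, and it costs one factor \<open>\<mu>\<close>.\<close>

lemma sum_indep_containing:
  fixes \<mu> :: real
  assumes "finite X" "u \<in> X"
  shows "(\<Sum>A | A \<in> indep X \<and> u \<in> A. \<mu> ^ card A) =
    \<mu> * (\<Sum>A | A \<in> indep X \<and> u \<notin> A \<and> A \<inter> nbhd X u = {}. \<mu> ^ card A)"
proof -
  let ?F = "{A. A \<in> indep X \<and> u \<notin> A \<and> A \<inter> nbhd X u = {}}"
  have eq: "{A. A \<in> indep X \<and> u \<in> A} = insert u ` ?F"
  proof (intro equalityI subsetI)
    fix A assume A: "A \<in> {A. A \<in> indep X \<and> u \<in> A}"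
    then have "A - {u} \<in> ?F" by (auto simp: indep_def nbhd_def)
    moreover have "A = insert u (A - {u})" using A by auto
    ultimately show "A \<in> insert u ` ?F" by blast
  next
    fix A assume "A \<in> insert u ` ?F"
    then obtain B where B: "B \<in> ?F" "A = insert u B" by blast
    then have "\<forall>w\<in>B. \<not> adj u w" by (auto simp: indep_def nbhd_def)
    then show "A \<in> {A. A \<in> indep X \<and> u \<in> A}"
      using B assms(2) adj_irrefl by (auto simp: indep_def dest: adj_sym)
  qed
  have inj: "inj_on (insert u) ?F"
    by (auto intro!: inj_onI)
  have "card (insert u A) = Suc (card A)" if "A \<in> ?F" for A
    using that indep_finite[OF assms(1)] by auto
  then show ?thesis
    unfolding eq sum.reindex[OF inj] sum_distrib_left by (intro sum.cong) auto
qed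

text \<open>For \<open>u\<close> in \<open>X\<close>, an independent set either contains
  \<open>u\<close>, or could be enlarged by \<open>u\<close>, or contains a neighbour of
  \<open>u\<close>. The second class weighs \<open>1 / \<mu>\<close> times the first, and the sets
  through a fixed neighbour weigh at most \<open>\<mu> * Z\<close>. Summing over \<open>u\<close>
  brings in \<open>t\<close>, a bound on the number of ordered adjacent pairs in
  \<open>X\<close>.\<close>

lemma size_sum_ge:
  assumes "finite X" "\<mu> > 0"
    and t: "(\<Sum>u\<in>X. real (card (nbhd X u))) \<le> t"
  shows "\<mu> * (real (card X) - \<mu> * t) * partition_fn \<mu> X \<le> (1 + \<mu>) * size_sum \<mu> X"
proof -
  define Z where "Z = partition_fn \<mu> X"
  define z where "z u = (\<Sum>A | A \<in> indep X \<and> u \<in> A. \<mu> ^ card A)" for u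
  define f where "f u = (\<Sum>A | A \<in> indep X \<and> u \<notin> A \<and> A \<inter> nbhd X u = {}. \<mu> ^ card A)" for u
  have fin: "finite (indep X)" by (rule finite_indep[OF assms(1)])
  have zf: "z u = \<mu> * f u" if "u \<in> X" for u
    unfolding z_def f_def by (rule sum_indep_containing[OF assms(1) that])
  have fZ: "f u \<le> Z" for u
    unfolding f_def Z_def partition_fn_def using fin assms(2) by (intro sum_mono2) auto
  have zZ: "z u \<le> \<mu> * Z" if "u \<in> X" for u
    using zf[OF that] fZ assms(2) by simp
  have "Z \<ge> 1" unfolding Z_def using assms by (intro partition_fn_ge_1) auto
  have one: "\<mu> * Z \<le> (1 + \<mu>) * z u + \<mu> * (real (card (nbhd X u)) * (\<mu> * Z))" if u: "u \<in> X" for u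
  proof -
    have cover: "indep X \<subseteq> ({A. A \<in> indep X \<and> u \<in> A} \<union>
        {A. A \<in> indep X \<and> u \<notin> A \<and> A \<inter> nbhd X u = {}}) \<union>
        (\<Union>w\<in>nbhd X u. {A. A \<in> indep X \<and> w \<in> A})" (is "_ \<subseteq> (?a \<union> ?b) \<union> ?c")
      by auto
    have nonneg: "\<And>A. 0 \<le> \<mu> ^ card A" using assms(2) by simp
    have finc: "finite ?c" using finite_nbhd[OF assms(1)] fin by auto
    have "Z \<le> (\<Sum>A\<in>(?a \<union> ?b) \<union> ?c. \<mu> ^ card A)"
      unfolding Z_def partition_fn_def using fin finc nonneg cover
      by (intro sum_mono2) auto
    also have "\<dots> \<le> (\<Sum>A\<in>?a \<union> ?b. \<mu> ^ card A) + (\<Sum>A\<in>?c. \<mu> ^ card A)"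
      using fin finc nonneg by (subst sum_Un) (auto intro!: sum_nonneg)
    also have "(\<Sum>A\<in>?a \<union> ?b. \<mu> ^ card A) = z u + f u"
      unfolding z_def f_def using fin by (subst sum.union_disjoint) auto
    also have "(\<Sum>A\<in>?c. \<mu> ^ card A) \<le> (\<Sum>w\<in>nbhd X u. z w)"
      unfolding z_def using finite_nbhd[OF assms(1)] fin nonneg by (intro sum_UN_le) auto
    also have "\<dots> \<le> (\<Sum>w\<in>nbhd X u. \<mu> * Z)"
      by (intro sum_mono zZ) (auto simp: nbhd_def)
    finally have "Z \<le> z u + f u + real (card (nbhd X u)) * (\<mu> * Z)" by simp
    then have "\<mu> * Z \<le> \<mu> * (z u + f u + real (card (nbhd X u)) * (\<mu> * Z))"
      using assms(2) by (intro mult_left_mono) auto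
    then show ?thesis using zf[OF u] by (simp add: algebra_simps)
  qed
  have "(\<Sum>u\<in>X. \<mu> * Z) \<le> (\<Sum>u\<in>X. (1 + \<mu>) * z u + \<mu> * (real (card (nbhd X u)) * (\<mu> * Z)))"
    by (intro sum_mono one)
  also have "\<dots> = (1 + \<mu>) * size_sum \<mu> X + \<mu> * (\<mu> * Z) * (\<Sum>u\<in>X. real (card (nbhd X u)))"
    unfolding size_sum_eq[OF assms(1)] z_def
    by (simp add: sum.distrib sum_distrib_left mult_ac)
  also have "\<dots> \<le> (1 + \<mu>) * size_sum \<mu> X + \<mu> * (\<mu> * Z) * t"
    using assms(2) \<open>Z \<ge> 1\<close> t by (intro add_left_mono mult_left_mono) auto
  finally show ?thesis unfolding Z_def[symmetric] by (simp add: algebra_simps)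
qed

section \<open>Conditioning on the part of an independent set outside a closed neighbourhood\<close>

text \<open>Once the part \<open>J\<close> outside the closed neighbourhood of \<open>v\<close> is
  fixed, either \<open>v\<close> is chosen, which excludes all its neighbours, or an arbitrary
  independent set of neighbours of \<open>v\<close> without neighbours in \<open>J\<close> is
  chosen.\<close>

lemma indep_fibre:
  assumes v: "v \<in> S" and J: "J \<in> indep S" "J \<inter> insert v (nbhd S v) = {}"
  shows "{I \<in> indep S. I - insert v (nbhd S v) = J} =
    insert (insert v J) ((\<lambda>A. J \<union> A) ` indep {u \<in> nbhd S v. \<forall>w\<in>J. \<not> adj u w})"
    (is "?F = insert _ (_ ` indep ?X)")
proof (intro equalityI subsetI)
  fix I assume I: "I \<in> ?F"
  then have Ii: "\<forall>x\<in>I. \<forall>y\<in>I. \<not> adj x y" "I \<subseteq> S" by (auto simp: indep_def)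
  show "I \<in> insert (insert v J) ((\<lambda>A. J \<union> A) ` indep ?X)"
  proof (cases "v \<in> I")
    case True
    then have "I \<inter> nbhd S v = {}" using Ii by (auto simp: nbhd_def)
    then have "I = insert v J" using I True by auto
    then show ?thesis by simp
  next
    case False
    then have "I = J \<union> (I \<inter> nbhd S v)" using I by auto
    moreover have "I \<inter> nbhd S v \<in> indep ?X"
      using Ii I by (auto simp: indep_def)
    ultimately show ?thesis by blast
  qed
next
  fix I assume "I \<in> insert (insert v J) ((\<lambda>A. J \<union> A) ` indep ?X)"
  then consider "I = insert v J" | A where "A \<in> indep ?X" "I = J \<union> A" by blast
  then show "I \<in> ?F"
  proof cases
    case 1
    have "\<forall>w\<in>J. \<not> adj v w" using J by (auto simp: indep_def nbhd_def)
    then show ?thesis using 1 v J adj_irrefl by (auto simp: indep_def dest: adj_sym)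
  next
    case 2
    then have "A \<subseteq> nbhd S v" by (auto simp: indep_def)
    moreover have "J \<union> A \<in> indep S"
      using 2 J by (auto simp: indep_def nbhd_def) (blast dest: adj_sym)
    ultimately show ?thesis using 2 J by auto
  qed
qed

text \<open>The independent sets are grouped by their part \<open>J\<close> outside the closed
  neighbourhood of \<open>v\<close>. Up to the common factor \<open>\<mu> ^ card J\<close>, each
  group contributes \<open>\<mu> + partition_fn \<mu> X\<close> to the left sum and
  \<open>D * \<mu> + size_sum \<mu> X\<close> to the right sum, with \<open>X\<close> the available
  neighbours, so \<open>loc\<close> applies group by group.\<close>

lemma local_occupancy:
  assumes "finite S" "v \<in> S" "\<mu> > 0"
    and loc: "\<And>X. X \<subseteq> nbhd S v \<Longrightarrow> \<beta> * (\<mu> + partition_fn \<mu> X) \<le> D * \<mu> + size_sum \<mu> X"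
  shows "\<beta> * partition_fn \<mu> S \<le>
    (\<Sum>I\<in>indep S. \<mu> ^ card I * (D * of_bool (v \<in> I) + real (card (I \<inter> nbhd S v))))"
    (is "_ \<le> (\<Sum>I\<in>_. ?h I)")
proof -
  define N where "N = nbhd S v"
  define g where "g = (\<lambda>I. I - insert v N)"
  have fin: "finite (indep S)" by (rule finite_indep[OF assms(1)])
  have vN: "v \<notin> N" by (simp add: N_def nbhd_def adj_irrefl)
  have finN: "finite N" unfolding N_def by (rule finite_nbhd[OF assms(1)])
  have one: "\<beta> * (\<Sum>I | I \<in> indep S \<and> g I = J. \<mu> ^ card I) \<le> (\<Sum>I | I \<in> indep S \<and> g I = J. ?h I)"
    if JT: "J \<in> g ` indep S" for J
  proof -
    have J: "J \<in> indep S" "J \<inter> insert v N = {}"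
      using JT by (auto simp: g_def indep_def)
    have finJ: "finite J" using indep_finite[OF assms(1) J(1)] .
    define X where "X = {u \<in> N. \<forall>w\<in>J. \<not> adj u w}"
    have finX: "finite X" using finN by (simp add: X_def)
    have XN: "X \<subseteq> N" by (auto simp: X_def)
    have fib: "{I. I \<in> indep S \<and> g I = J} = insert (insert v J) ((\<lambda>A. J \<union> A) ` indep X)"
      using indep_fibre[OF assms(2) J[unfolded N_def]] by (simp add: g_def N_def X_def)
    have AX: "A \<subseteq> X" if "A \<in> indep X" for A using that by (simp add: indep_def)
    have disj: "J \<inter> A = {}" if "A \<in> indep X" for A
      using AX[OF that] XN J(2) by blast
    have inj: "inj_on (\<lambda>A. J \<union> A) (indep X)"
    proof (rule inj_onI)
      fix A B assume "A \<in> indep X" "B \<in> indep X" "J \<union> A = J \<union> B"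
      then show "A = B" using disj[of A] disj[of B] by blast
    qed
    have notin: "insert v J \<notin> (\<lambda>A. J \<union> A) ` indep X"
      using vN J(2) AX XN by blast
    have cardU: "card (J \<union> A) = card J + card A" if "A \<in> indep X" for A
      using disj[OF that] finJ indep_finite[OF finX that] by (simp add: card_Un_disjoint)
    have finI: "finite ((\<lambda>A. J \<union> A) ` indep X)" using finite_indep[OF finX] by simp
    have split: "(\<Sum>I | I \<in> indep S \<and> g I = J. F I) =
        F (insert v J) + (\<Sum>A\<in>indep X. F (J \<union> A))" for F :: "'a set \<Rightarrow> real"
      unfolding fib using notin finI by (simp add: sum.reindex[OF inj])
    have card_v: "card (insert v J) = Suc (card J)" using J(2) finJ by simp
    have "(\<Sum>I | I \<in> indep S \<and> g I = J. \<mu> ^ card I) = \<mu> ^ card J * (\<mu> + partition_fn \<mu> X)"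
      unfolding split card_v partition_fn_def
      by (simp add: cardU power_add sum_distrib_left distrib_left)
    moreover have "(\<Sum>I | I \<in> indep S \<and> g I = J. ?h I) = \<mu> ^ card J * (D * \<mu> + size_sum \<mu> X)"
    proof -
      have "insert v J \<inter> N = {}" using J(2) vN by auto
      then have "?h (insert v J) = \<mu> ^ card J * (D * \<mu>)"
        by (simp add: card_v N_def[symmetric])
      moreover have "?h (J \<union> A) = \<mu> ^ card J * (\<mu> ^ card A * real (card A))" if "A \<in> indep X" for A
      proof -
        have "(J \<union> A) \<inter> N = A" "v \<notin> J \<union> A" using AX[OF that] XN J(2) vN by auto
        then show ?thesis by (simp add: cardU[OF that] power_add N_def[symmetric] del: Un_iff)
      qed
      ultimately show ?thesis
        unfolding split size_sum_def by (simp add: sum_distrib_left distrib_left)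
    qed
    moreover have "\<beta> * (\<mu> ^ card J * (\<mu> + partition_fn \<mu> X)) \<le> \<mu> ^ card J * (D * \<mu> + size_sum \<mu> X)"
      using loc[of X] XN assms(3) by (simp add: N_def mult.left_commute)
    ultimately show ?thesis by simp
  qed
  have "\<beta> * partition_fn \<mu> S = (\<Sum>J\<in>g ` indep S. \<beta> * (\<Sum>I | I \<in> indep S \<and> g I = J. \<mu> ^ card I))"
    unfolding partition_fn_def sum_distrib_left[symmetric]
    by (subst sum.group[OF fin, of "g ` indep S" g]) (use fin in auto)
  also have "\<dots> \<le> (\<Sum>J\<in>g ` indep S. \<Sum>I | I \<in> indep S \<and> g I = J. ?h I)"
    by (intro sum_mono one)
  also have "\<dots> = (\<Sum>I\<in>indep S. ?h I)"
    by (rule sum.group[OF fin]) (use fin in auto)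
  finally show ?thesis .
qed

text \<open>\<open>local_occupancy\<close> is summed over all \<open>v\<close>. A member of
  \<open>I\<close> is counted with weight \<open>D\<close> at itself and once at each of its at most
  \<open>D\<close> neighbours, so the average of \<open>2 * D * card I\<close> is at least
  \<open>card S * \<beta>\<close>, and some \<open>I\<close> reaches the average.\<close>

lemma large_indep_exists:
  assumes "finite S" "\<mu> > 0" "D > 0"
    and deg: "\<And>v. v \<in> S \<Longrightarrow> real (card (nbhd S v)) \<le> D"
    and loc: "\<And>v X. v \<in> S \<Longrightarrow> X \<subseteq> nbhd S v \<Longrightarrow>
      \<beta> * (\<mu> + partition_fn \<mu> X) \<le> D * \<mu> + size_sum \<mu> X"
  shows "\<exists>I\<in>indep S. real (card S) * \<beta> \<le> 2 * D * real (card I)"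
proof (rule ccontr)
  assume neg: "\<not> ?thesis"
  have fin: "finite (indep S)" by (rule finite_indep[OF assms(1)])
  let ?h = "\<lambda>v I. \<mu> ^ card I * (D * of_bool (v \<in> I) + real (card (I \<inter> nbhd S v)))"
  have "real (card S) * (\<beta> * partition_fn \<mu> S) = (\<Sum>v\<in>S. \<beta> * partition_fn \<mu> S)" by simp
  also have "\<dots> \<le> (\<Sum>v\<in>S. \<Sum>I\<in>indep S. ?h v I)"
    by (intro sum_mono local_occupancy assms(1,2) loc)
  also have "\<dots> = (\<Sum>I\<in>indep S. \<mu> ^ card I * (\<Sum>v\<in>S. D * of_bool (v \<in> I) + real (card (I \<inter> nbhd S v))))"
    by (subst sum.swap) (simp add: sum_distrib_left)
  also have "\<dots> \<le> (\<Sum>I\<in>indep S. \<mu> ^ card I * (2 * D * real (card I)))"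
  proof (intro sum_mono mult_left_mono)
    fix I assume I: "I \<in> indep S"
    then have IS: "I \<subseteq> S" by (simp add: indep_def)
    then have finI: "finite I" using assms(1) finite_subset by blast
    \<comment> \<open>Double counting of the adjacent pairs with second entry in
      \<open>I\<close>.\<close>
    have "(\<Sum>v\<in>S. real (card (I \<inter> nbhd S v))) = (\<Sum>v\<in>S. \<Sum>w | w \<in> I \<and> adj v w. 1)"
      using IS by (intro sum.cong refl) (auto simp: nbhd_def intro!: arg_cong[of _ _ card])
    also have "\<dots> = (\<Sum>w\<in>I. \<Sum>v | v \<in> S \<and> adj v w. 1)"
      by (rule sum.swap_restrict[OF assms(1) finI])
    also have "\<dots> = (\<Sum>w\<in>I. real (card (nbhd S w)))"
      by (intro sum.cong refl) (auto simp: nbhd_def dest: adj_sym intro!: arg_cong[of _ _ card])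
    also have "\<dots> \<le> (\<Sum>w\<in>I. D)" using IS by (intro sum_mono deg) auto
    finally have "(\<Sum>v\<in>S. real (card (I \<inter> nbhd S v))) \<le> D * real (card I)"
      by (simp add: mult.commute)
    moreover have "(\<Sum>v\<in>S. D * of_bool (v \<in> I)) = D * real (card I)"
      using IS assms(1) by (simp add: sum_distrib_left[symmetric] of_bool_def sum.If_cases Int_absorb1)
    ultimately show "(\<Sum>v\<in>S. D * of_bool (v \<in> I) + real (card (I \<inter> nbhd S v))) \<le> 2 * D * real (card I)"
      by (simp add: sum.distrib)
  qed (use assms in auto)
  \<comment> \<open>Strict because the weights are positive and the empty set is
    independent.\<close>
  also have "\<dots> < (\<Sum>I\<in>indep S. \<mu> ^ card I * (real (card S) * \<beta>))"
    using neg fin assms(2) empty_in_indep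
    by (intro sum_strict_mono) (auto simp: not_le)
  also have "\<dots> = real (card S) * (\<beta> * partition_fn \<mu> S)"
    by (simp add: partition_fn_def sum_distrib_left mult_ac)
  finally show False by simp
qed

text \<open>An independent set of maximum size cannot be enlarged, so its closed neighbourhoods
  cover \<open>S\<close>.\<close>

lemma maximal_indep_card:
  assumes "finite S" and deg: "\<And>v. v \<in> S \<Longrightarrow> Suc (card (nbhd S v)) \<le> D"
  shows "\<exists>I\<in>indep S. card S \<le> D * card I"
proof -
  have "Max (card ` indep S) \<in> card ` indep S"
    using finite_indep[OF assms(1)] empty_in_indep[of S] by (intro Max_in) auto
  then obtain I where I: "I \<in> indep S" and "card I = Max (card ` indep S)" by auto
  then have max: "card J \<le> card I" if "J \<in> indep S" for J
    using finite_indep[OF assms(1)] that by simp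
  have finI: "finite I" and IS: "I \<subseteq> S"
    using indep_finite[OF assms(1) I] I by (auto simp: indep_def)
  have "S \<subseteq> (\<Union>v\<in>I. insert v (nbhd S v))"
  proof
    fix x assume x: "x \<in> S"
    show "x \<in> (\<Union>v\<in>I. insert v (nbhd S v))"
    proof (rule ccontr)
      assume nx: "x \<notin> (\<Union>v\<in>I. insert v (nbhd S v))"
      then have "\<forall>v\<in>I. \<not> adj v x" "x \<notin> I" using x by (auto simp: nbhd_def)
      then have "insert x I \<in> indep S"
        using I x adj_irrefl by (auto simp: indep_def dest: adj_sym)
      from max[OF this] show False using \<open>x \<notin> I\<close> finI by simp
    qed
  qed
  then have "card S \<le> card (\<Union>v\<in>I. insert v (nbhd S v))"
    using finI finite_nbhd[OF assms(1)] by (intro card_mono) auto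
  also have "\<dots> \<le> (\<Sum>v\<in>I. card (insert v (nbhd S v)))" by (rule card_UN_le[OF finI])
  also have "\<dots> \<le> (\<Sum>v\<in>I. D)"
  proof (rule sum_mono)
    fix v assume "v \<in> I"
    then have "Suc (card (nbhd S v)) \<le> D" using IS deg by auto
    then show "card (insert v (nbhd S v)) \<le> D"
      using finite_nbhd[OF assms(1)] by (simp add: card_insert_if)
  qed
  finally show ?thesis using I by (auto simp: mult.commute)
qed


section \<open>Choice of the fugacity and numerical estimates\<close>

text \<open>The value of \<open>\<mu>\<close> makes the loss
  \<open>\<mu> * (\<mu> * (6 * e))\<close> in \<open>size_sum_ge\<close> equal to 1/2. For small
  \<open>X\<close> the term \<open>D * \<mu>\<close> alone suffices, for large \<open>X\<close> the
  term \<open>size_sum \<mu> X\<close> does.\<close>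

lemma local_inequality:
  fixes D e M :: real
  assumes "finite X" "D > 0" "e \<ge> 1"
    and M: "M = 2 * log 2 D - log 2 e" "M \<ge> 20"
    and \<mu>: "\<mu> = 1 / sqrt (12 * e)"
    and t: "(\<Sum>u\<in>X. real (card (nbhd X u))) \<le> 6 * e"
  shows "M / 10 * (\<mu> + partition_fn \<mu> X) \<le> D * \<mu> + size_sum \<mu> X"
proof -
  define Z where "Z = partition_fn \<mu> X"
  define y where "y = \<mu> * real (card X)"
  have sqrt_e: "sqrt e \<ge> 1" using assms(3) by simp
  \<comment> \<open>A rational bound sharp enough for \<open>(1 + \<mu>)\<^sup>2 \<le> 5 / 3\<close>
    below, where 5/3 is the ratio of \<open>M / 6\<close> to \<open>M / 10\<close>.\<close>
  have "sqrt 12 \<ge> (69 / 20 :: real)" by (rule real_le_rsqrt) (simp add: power2_eq_square)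
  have sqrt12: "sqrt 12 \<le> (7 / 2 :: real)" by (rule real_le_lsqrt) (simp_all add: power2_eq_square)
  have \<mu>_pos: "\<mu> > 0" using assms(3) \<mu> by simp
  have "69 / 20 * 1 \<le> sqrt 12 * sqrt e"
    using \<open>sqrt 12 \<ge> 69 / 20\<close> sqrt_e by (intro mult_mono) auto
  then have \<mu>_le: "\<mu> \<le> 1 / (69 / 20)"
    unfolding \<mu> real_sqrt_mult by (intro divide_left_mono) auto
  have \<mu>_sq: "\<mu> * \<mu> = 1 / (12 * e)"
    using assms(3) by (simp add: \<mu>)
  have "1 / (12 * e) \<le> 1 / 12" using assms(3) by (simp add: field_simps)
  then have "\<mu> * \<mu> \<le> 1 / 12" using \<mu>_sq by simp
  moreover have "(1 + \<mu>) * (1 + \<mu>) = 1 + 2 * \<mu> + \<mu> * \<mu>" by (simp add: algebra_simps)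
  ultimately have \<mu>1: "(1 + \<mu>) * (1 + \<mu>) \<le> 5 / 3" using \<mu>_le by simp
  have \<mu>t: "\<mu> * (\<mu> * (6 * e)) = 1 / 2"
    using assms(3) \<mu>_sq by (simp add: mult.assoc[symmetric])
  have Z1: "Z \<ge> 1" unfolding Z_def using assms(1) \<mu>_pos by (intro partition_fn_ge_1) auto
  have size_nonneg: "size_sum \<mu> X \<ge> 0"
    unfolding size_sum_def using \<mu>_pos by (intro sum_nonneg) auto
  show ?thesis
  \<comment> \<open>Above this threshold, \<open>y\<close> less the loss 1/2 still exceeds
    \<open>M / 6\<close>.\<close>
  proof (cases "y \<le> 1 / 2 + M / 6")
    case True
    define q where "q = exp (M / 6)"
    have q_pos: "q > 0" by (simp add: q_def)
    have "Z \<le> exp y"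
      unfolding Z_def y_def using assms(1) \<mu>_pos by (intro partition_fn_le_exp) auto
    also have "\<dots> \<le> exp (1 / 2 + M / 6)" using True by simp
    also have "\<dots> = exp (1 / 2) * q" by (simp add: exp_add q_def)
    also have "\<dots> \<le> 7 / 4 * q"
      using exp_bound[of "1 / 2"] q_pos by (intro mult_right_mono) (auto simp: power2_eq_square)
    finally have Zq: "Z \<le> 7 / 4 * q" .
    have q1: "q \<ge> 1" using M(2) by (simp add: q_def)
    have "(5 / 2 :: real) \<le> exp 1" using exp_lower_Taylor_quadratic[of 1] by simp
    then have "(5 / 2 :: real) ^ 3 \<le> exp 1 ^ 3" by (intro power_mono) auto
    also have "exp 1 ^ 3 = (exp 3 :: real)" by (simp add: exp_of_nat_mult[symmetric])
    finally have e3: "(125 / 8 :: real) \<le> exp 3" by (simp add: power3_eq_cube)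
    \<comment> \<open>The tangent of the exponential at 3 bounds \<open>q\<close> below by a line in
      \<open>M\<close>, which lies above \<open>3 / 4 * M\<close> once
      \<open>M \<ge> 20\<close>.\<close>
    have "1 + (M / 6 - 3) \<le> exp (M / 6 - 3)" by (rule exp_ge_add_one_self)
    then have "125 / 8 * (M / 6 - 2) \<le> exp 3 * exp (M / 6 - 3)"
      using e3 M(2) by (intro mult_mono) auto
    also have "\<dots> = q" by (simp add: exp_add[symmetric] q_def)
    finally have qM: "q \<ge> 3 / 4 * M" using M(2) by simp
    \<comment> \<open>The right side is 2 to the power \<open>M / 2\<close>, that is
      \<open>D / sqrt e\<close>. Hence \<open>D * \<mu>\<close> is of order \<open>q * q\<close>,
      whereas \<open>Z\<close> is only of order \<open>q\<close>.\<close>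
    have "exp (M / 3) \<le> exp (M * ln 2 / 2)"
      using ln2_ge_two_thirds M(2) mult_left_mono[of "2/3" "ln 2" M] by simp
    also have "\<dots> = D / sqrt e"
    proof -
      have "M * ln 2 / 2 = ln D - ln (sqrt e)"
        using M(1) assms(2,3) by (simp add: log_def ln_sqrt field_simps)
      then show ?thesis using assms(2,3) by (simp only: exp_diff) simp
    qed
    finally have "q * q \<le> D / sqrt e" by (simp add: q_def exp_add[symmetric])
    then have "q * q / sqrt 12 \<le> D / sqrt e / sqrt 12" by (intro divide_right_mono) auto
    also have "\<dots> = D * \<mu>" by (simp add: \<mu> real_sqrt_mult mult.commute)
    finally have D\<mu>: "q * q / sqrt 12 \<le> D * \<mu>" .
    \<comment> \<open>Here \<open>\<mu> \<le> 3 / 10\<close> and \<open>q \<ge> 1\<close>. The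
      resulting 41/200 is below 3/14, the product of 3/4 from \<open>qM\<close> and 2/7 from
      \<open>sqrt12\<close>.\<close>
    have "M / 10 * (\<mu> + Z) \<le> M / 10 * (3 / 10 * q + 7 / 4 * q)"
      using Zq \<mu>_le q1 M(2) by (intro mult_left_mono) auto
    also have "\<dots> = (41 / 200) * M * q" by simp
    also have "\<dots> \<le> q * q / (7 / 2)"
      using mult_right_mono[OF qM, of q] q_pos M(2) by (simp add: field_simps)
    also have "\<dots> \<le> q * q / sqrt 12"
      using sqrt12 q_pos by (intro divide_left_mono) auto
    finally show ?thesis using D\<mu> size_nonneg unfolding Z_def by linarith
  next
    case False
    have "\<mu> * (real (card X) - \<mu> * (6 * e)) = y - 1 / 2"
      using \<mu>t by (simp add: y_def right_diff_distrib)
    then have "(y - 1 / 2) * Z \<le> (1 + \<mu>) * size_sum \<mu> X"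
      using size_sum_ge[OF assms(1) \<mu>_pos t] by (simp add: Z_def)
    moreover have "M / 6 * Z \<le> (y - 1 / 2) * Z"
      using False Z1 by (intro mult_right_mono) auto
    moreover have "(1 + \<mu>) * ((1 + \<mu>) * (M / 10 * Z)) \<le> M / 6 * Z"
      using mult_right_mono[OF \<mu>1, of "M / 10 * Z"] Z1 M(2) by (simp add: mult.assoc)
    ultimately have "(1 + \<mu>) * ((1 + \<mu>) * (M / 10 * Z)) \<le> (1 + \<mu>) * size_sum \<mu> X" by linarith
    then have "(1 + \<mu>) * (M / 10 * Z) \<le> size_sum \<mu> X" using \<mu>_pos by simp
    moreover have "M / 10 * (\<mu> + Z) \<le> M / 10 * ((1 + \<mu>) * Z)"
      using M(2) Z1 \<mu>_pos mult_left_mono[of 1 Z \<mu>] by (intro mult_left_mono) (auto simp: algebra_simps)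
    moreover have "M / 10 * ((1 + \<mu>) * Z) = (1 + \<mu>) * (M / 10 * Z)" by simp
    moreover have "D * \<mu> > 0" using assms(2) \<mu>_pos by simp
    ultimately show ?thesis unfolding Z_def by linarith
  qed
qed

text \<open>With \<open>M\<close> as in the proof, the bound equals
  \<open>card S * M / (20 * D)\<close>. For \<open>M < 20\<close> this is at most
  \<open>card S / D\<close>, which a maximum independent set attains; otherwise
  \<open>large_indep_exists\<close> applies with \<open>M / 10\<close> for
  \<open>\<beta>\<close>.\<close>

lemma locally_sparse_indep:
  fixes e :: real
  assumes "finite S" "e \<ge> 1" "D > 0"
    and deg: "\<And>v. v \<in> S \<Longrightarrow> Suc (card (nbhd S v)) \<le> D"
    and sparse: "\<And>v. v \<in> S \<Longrightarrow>
      real (\<Sum>u\<in>nbhd S v. card (nbhd (nbhd S v) u)) \<le> 6 * e"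
  shows "\<exists>I\<in>indep S. real (card S) / (10 * real D) *
    (log 2 (real D) - 1 / 2 * log 2 e) \<le> real (card I)"
proof (cases "2 * log 2 (real D) - log 2 e \<ge> 20")
  case True
  define M where "M = 2 * log 2 (real D) - log 2 e"
  define \<mu> where "\<mu> = 1 / sqrt (12 * e)"
  have "\<exists>I\<in>indep S. real (card S) * (M / 10) \<le> 2 * real D * real (card I)"
  proof (rule large_indep_exists[OF assms(1)])
    show "\<mu> > 0" using assms(2) by (simp add: \<mu>_def)
    show "real D > 0" using assms(3) by simp
    show "real (card (nbhd S v)) \<le> real D" if "v \<in> S" for v using deg[OF that] by simp
    fix v X assume v: "v \<in> S" and X: "X \<subseteq> nbhd S v"
    have fin: "finite (nbhd S v)" "finite X" using finite_nbhd[OF assms(1)] X finite_subset by auto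
    \<comment> \<open>Sparsity of the whole neighbourhood passes to its subsets.\<close>
    have "(\<Sum>u\<in>X. card (nbhd X u)) \<le> (\<Sum>u\<in>X. card (nbhd (nbhd S v) u))"
      using X fin(1) by (intro sum_mono card_mono finite_nbhd[OF fin(1)]) (auto simp: nbhd_def)
    also have "\<dots> \<le> (\<Sum>u\<in>nbhd S v. card (nbhd (nbhd S v) u))"
      using X fin(1) by (intro sum_mono2) auto
    finally have "real (\<Sum>u\<in>X. card (nbhd X u)) \<le> 6 * e"
      using sparse[OF v] by linarith
    then show "M / 10 * (\<mu> + partition_fn \<mu> X) \<le> real D * \<mu> + size_sum \<mu> X"
      using True assms(2,3) fin(2)
      by (intro local_inequality[of _ _ e]) (auto simp: M_def \<mu>_def)
  qed
  then obtain I where I: "I \<in> indep S" "real (card S) * (M / 10) \<le> 2 * real D * real (card I)"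
    by blast
  have "real (card S) / (10 * real D) * (log 2 (real D) - 1 / 2 * log 2 e) =
      real (card S) * (M / 10) / (2 * real D)"
    using assms(3) by (simp add: M_def field_simps)
  also have "\<dots> \<le> real (card I)"
    using I(2) assms(3) by (simp add: divide_le_eq mult_ac)
  finally show ?thesis using I(1) by blast
next
  case False
  obtain I where I: "I \<in> indep S" "card S \<le> D * card I"
    using maximal_indep_card[OF assms(1) deg] by blast
  have "real (card S) / (10 * real D) * (log 2 (real D) - 1 / 2 * log 2 e) \<le>
      real (card S) / (10 * real D) * 10"
    using False by (intro mult_left_mono) auto
  also have "\<dots> = real (card S) / real D" by simp
  also have "\<dots> \<le> real (card I)"
    using I(2) assms(3) by (simp add: divide_le_eq mult.commute flip: of_nat_mult)
  finally show ?thesis using I(1) by blast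
qed

end

section \<open>Counting permutations near a given one\<close>

definition supp :: "nat \<Rightarrow> (nat \<Rightarrow> nat) \<Rightarrow> nat set" where
  "supp n x = {i \<in> {..<n}. x i \<noteq> i}"

lemma finite_supp [simp]: "finite (supp n x)"
  by (simp add: supp_def)

lemma hamming_id: "hamming n id x = card (supp n x)"
  by (auto simp: hamming_def supp_def intro!: arg_cong[of _ _ card])

lemma hamming_commute: "hamming n x y = hamming n y x"
  by (auto simp: hamming_def intro!: arg_cong[of _ _ card])

lemma hamming_comp_left:
  assumes "inj v"
  shows "hamming n (v \<circ> x) (v \<circ> y) = hamming n x y"
  using assms by (simp add: hamming_def inj_eq)

lemma permutes_supp: "x \<in> sym_grp n \<Longrightarrow> x permutes supp n x"
  unfolding sym_grp_def by (auto intro: permutes_superset simp: supp_def)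

text \<open>No permutation moves exactly one point; hence the sums in \<open>E\<close> may start at
  2.\<close>

lemma supp_card_ge_2:
  assumes "x \<in> sym_grp n" "x \<noteq> id"
  shows "card (supp n x) \<ge> 2"
proof (rule ccontr)
  assume "\<not> ?thesis"
  then have "card (supp n x) = 0 \<or> card (supp n x) = 1" by linarith
  then have "supp n x = {} \<or> (\<exists>a. supp n x = {a})" by (auto simp: card_1_singleton_iff)
  then show False using permutes_supp[OF assms(1)] assms(2) by auto
qed

lemma card_derangements_on:
  assumes "finite A"
  shows "card {p. p permutes A \<and> (\<forall>a\<in>A. p a \<noteq> a)} = derangements (card A)"
proof -
  obtain f where f: "bij_betw f {..<card A} A"
    using assms by (metis ex_bij_betw_nat_finite atLeast0LessThan)
  from bij_betw_same_card[OF bij_betw_derangements[OF f]]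
  show ?thesis by (simp add: derangements_def sym_grp_def Ball_def)
qed

text \<open>A permutation restricts to a derangement of its support, and there are
  \<open>n choose i\<close> candidates for a support of size \<open>i\<close>.\<close>

lemma card_weight_le:
  "card {x \<in> sym_grp n. card (supp n x) = i} \<le> (n choose i) * derangements i"
proof -
  let ?I = "{A. A \<subseteq> {..<n} \<and> card A = i}"
  let ?F = "\<lambda>A. {p. p permutes A \<and> (\<forall>a\<in>A. p a \<noteq> a)}"
  have finI: "finite ?I" by (rule finite_subset[of _ "Pow {..<n}"]) auto
  have fin: "finite A" if "A \<in> ?I" for A using that finite_subset[of A "{..<n}"] by auto
  have "card {x \<in> sym_grp n. card (supp n x) = i} \<le> card (\<Union>A\<in>?I. ?F A)"
  proof (rule card_mono)
    show "finite (\<Union>A\<in>?I. ?F A)"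
      using finI finite_permutations[OF fin] by auto
    show "{x \<in> sym_grp n. card (supp n x) = i} \<subseteq> (\<Union>A\<in>?I. ?F A)"
    proof
      fix x assume x: "x \<in> {x \<in> sym_grp n. card (supp n x) = i}"
      then have "supp n x \<in> ?I" "x \<in> ?F (supp n x)"
        using permutes_supp[of x n] by (auto simp: supp_def)
      then show "x \<in> (\<Union>A\<in>?I. ?F A)" by blast
    qed
  qed
  also have "\<dots> \<le> (\<Sum>A\<in>?I. card (?F A))" by (rule card_UN_le[OF finI])
  also have "\<dots> = (\<Sum>A\<in>?I. derangements i)"
    using card_derangements_on[OF fin] by (intro sum.cong) auto
  also have "\<dots> = (n choose i) * derangements i"
    using n_subsets[of "{..<n}" i] by simp
  finally show ?thesis .
qed

lemma card_ball_le: "d > 0 \<Longrightarrow> card {x \<in> sym_grp n. card (supp n x) < d} \<le> V n (d - 1)"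
proof -
  assume "d > 0"
  then have "{x \<in> sym_grp n. card (supp n x) < d} =
      (\<Union>i\<in>{0..d - 1}. {x \<in> sym_grp n. card (supp n x) = i})" by auto
  then have "card {x \<in> sym_grp n. card (supp n x) < d} \<le>
      (\<Sum>i=0..d - 1. card {x \<in> sym_grp n. card (supp n x) = i})"
    using card_UN_le[of "{0..d - 1}"] by simp
  also have "\<dots> \<le> V n (d - 1)"
    unfolding V_def by (intro sum_mono card_weight_le)
  finally show ?thesis .
qed

section \<open>Permutations within a given distance of a fixed one\<close>

text \<open>Relative to one such permutation \<open>\<tau>0\<close>, every other one differs by a
  permutation that fixes \<open>U - W\<close> pointwise.\<close>

lemma card_permutes_agreeing_le:
  assumes "finite U" "W \<subseteq> U"
  shows "card {\<tau>. \<tau> permutes U \<and> (\<forall>x\<in>U - W. \<tau> x = f x)} \<le> fact (card W)"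
    (is "card ?T \<le> _")
proof (cases "?T = {}")
  case False
  then obtain \<tau>0 where t0: "\<tau>0 permutes U" "\<forall>x\<in>U - W. \<tau>0 x = f x" by auto
  have finW: "finite W" using assms finite_subset by auto
  have "card ?T \<le> card {p. p permutes W}"
  proof (rule card_inj_on_le)
    show "inj_on (\<lambda>\<tau>. inv \<tau>0 \<circ> \<tau>) ?T"
    proof (rule inj_onI)
      fix a b assume "inv \<tau>0 \<circ> a = inv \<tau>0 \<circ> b"
      then have "\<tau>0 \<circ> inv \<tau>0 \<circ> a = \<tau>0 \<circ> inv \<tau>0 \<circ> b" by (simp add: comp_assoc)
      then show "a = b" by (simp add: permutes_inv_o(1)[OF t0(1)])
    qed
    show "(\<lambda>\<tau>. inv \<tau>0 \<circ> \<tau>) ` ?T \<subseteq> {p. p permutes W}"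
    proof clarify
      fix \<tau> assume t: "\<tau> permutes U" "\<forall>x\<in>U - W. \<tau> x = f x"
      have "inv \<tau>0 \<circ> \<tau> permutes U"
        by (intro permutes_compose t permutes_inv t0)
      moreover have "(inv \<tau>0 \<circ> \<tau>) x = x" if "x \<in> U - W" for x
        using t(2) t0(2) that permutes_inverses(2)[OF t0(1)] by (metis comp_apply)
      ultimately show "inv \<tau>0 \<circ> \<tau> permutes W" by (auto intro: permutes_superset)
    qed
    show "finite {p. p permutes W}" by (rule finite_permutations[OF finW])
  qed
  then show ?thesis using card_permutations[OF refl finW] by simp
next
  case True
  then show ?thesis by (metis card.empty le0)
qed

lemma card_UN_le_const:
  assumes "finite I" "\<And>i. i \<in> I \<Longrightarrow> card (A i) \<le> c"
  shows "card (\<Union>i\<in>I. A i) \<le> card I * c"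
  using card_UN_le[OF assms(1), of A] sum_bounded_above[of I "\<lambda>i. card (A i)" c] assms(2)
  by (metis (no_types, lifting) le_trans of_nat_id)

text \<open>The differing points are those moved by exactly one of the two permutations and those
  moved by both to different places.\<close>

lemma hamming_supp:
  "hamming n \<sigma> \<tau> = (card (supp n \<sigma>) - card (supp n \<tau> \<inter> supp n \<sigma>)) +
     (card (supp n \<tau>) - card (supp n \<tau> \<inter> supp n \<sigma>)) +
     card {x \<in> supp n \<tau> \<inter> supp n \<sigma>. \<sigma> x \<noteq> \<tau> x}"
proof -
  let ?S = "supp n \<sigma>" and ?T = "supp n \<tau>"
  let ?D = "{x \<in> ?T \<inter> ?S. \<sigma> x \<noteq> \<tau> x}"
  have "{i \<in> {..<n}. \<sigma> i \<noteq> \<tau> i} = (?S - ?T \<inter> ?S) \<union> (?T - ?T \<inter> ?S) \<union> ?D"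
    by (auto simp: supp_def)
  then have "hamming n \<sigma> \<tau> = card ((?S - ?T \<inter> ?S) \<union> (?T - ?T \<inter> ?S) \<union> ?D)"
    by (simp add: hamming_def)
  also have "\<dots> = card ((?S - ?T \<inter> ?S) \<union> (?T - ?T \<inter> ?S)) + card ?D"
    by (rule card_Un_disjoint) auto
  also have "card ((?S - ?T \<inter> ?S) \<union> (?T - ?T \<inter> ?S)) = card (?S - ?T \<inter> ?S) + card (?T - ?T \<inter> ?S)"
    by (rule card_Un_disjoint) auto
  also have "card (?S - ?T \<inter> ?S) = card ?S - card (?T \<inter> ?S)"
    by (rule card_Diff_subset) auto
  also have "card (?T - ?T \<inter> ?S) = card ?T - card (?T \<inter> ?S)"
    by (rule card_Diff_subset) auto
  finally show ?thesis .
qed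

lemma finite_L_index: "finite {l. int l \<le> min a (int k)}"
  by (rule finite_subset[of _ "{..k}"]) auto

text \<open>A permutation \<open>\<tau>\<close> near \<open>\<sigma>\<close> is recorded by the part \<open>B\<close> of its support inside
  \<open>supp n \<sigma>\<close>, the part \<open>C\<close> outside, and the set \<open>D\<close> of points of \<open>B\<close> where \<open>\<sigma>\<close> and
  \<open>\<tau>\<close> differ; then \<open>\<tau>\<close> is prescribed off \<open>C \<union> D\<close>.\<close>
lemma card_near_le_L:
  assumes \<sigma>: "card (supp n \<sigma>) = i"
  shows "card {\<tau> \<in> sym_grp n. card (supp n \<tau>) = j \<and> hamming n \<sigma> \<tau> < d} \<le> L n d i j"
    (is "card ?T \<le> _")
proof -
  let ?S = "supp n \<sigma>"
  define K where "K = {ceil_plus ((real i + real j - real d + 1) / 2) .. min i j}"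
  define Lk where "Lk k = {l. int l \<le> min (int d + 2 * int k - int i - int j - 1) (int k)}" for k
  define Bs where "Bs k = {B. B \<subseteq> ?S \<and> card B = k}" for k
  define Cs where "Cs k = {C. C \<subseteq> {..<n} - ?S \<and> card C = j - k}" for k
  define Ds where "Ds B l = {D. D \<subseteq> B \<and> card D = (l::nat)}" for B :: "nat set" and l
  define F where "F B C D = {\<tau>. \<tau> permutes {..<n} \<and>
      (\<forall>x\<in>{..<n} - (C \<union> D). \<tau> x = (if x \<in> B then \<sigma> x else x))}" for B C D
  let ?U = "\<Union>k\<in>K. \<Union>l\<in>Lk k. \<Union>B\<in>Bs k. \<Union>C\<in>Cs k. \<Union>D\<in>Ds B l. F B C D"
  have fin: "finite K" "finite (Lk k)" "finite (Bs k)" "finite (Cs k)" for k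
    unfolding K_def Lk_def Bs_def Cs_def using finite_L_index
    by (auto intro: finite_subset[of _ "Pow ?S"] finite_subset[of _ "Pow ({..<n} - ?S)"])
  have finB: "finite B" if "B \<in> Bs k" for B k
    using that finite_subset[of B ?S] by (auto simp: Bs_def)
  have finD: "finite (Ds B l)" if "B \<in> Bs k" for B k l
    using finB[OF that] by (auto simp: Ds_def intro: finite_subset[of _ "Pow B"])
  have finF: "finite (F B C D)" for B C D
    using finite_permutations[of "{..<n}"] by (auto simp: F_def intro: finite_subset[rotated])
  have "?T \<subseteq> ?U"
  proof
    fix \<tau> assume t: "\<tau> \<in> ?T"
    define B where "B = supp n \<tau> \<inter> ?S"
    define C where "C = supp n \<tau> - ?S"
    define D where "D = {x \<in> B. \<sigma> x \<noteq> \<tau> x}"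
    have ki: "card B \<le> i" and kj: "card B \<le> j"
      using t \<sigma> by (auto simp: B_def intro: card_mono)
    have DB: "card D \<le> card B" by (rule card_mono) (auto simp: D_def B_def)
    have "(i - card B) + (j - card B) + card D < d"
    proof -
      have "hamming n \<sigma> \<tau> < d" "card (supp n \<tau>) = j" using t by auto
      then show ?thesis unfolding hamming_supp \<sigma> by (simp add: B_def D_def)
    qed
    \<comment> \<open>With \<open>k = card B\<close> and \<open>l = card D\<close> this is the upper
      limit for \<open>l\<close> in \<open>L\<close>; with \<open>l \<ge> 0\<close> it also yields
      the lower limit for \<open>k\<close>.\<close>
    then have "int i + int j + int (card D) < int d + 2 * int (card B)"
      using ki kj by linarith
    then have "card B \<in> K" "card D \<in> Lk (card B)"
      using ki kj DB by (auto simp: K_def Lk_def ceil_plus_eq nat_le_iff ceiling_le_iff)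
    moreover have "B \<in> Bs (card B)" "D \<in> Ds B (card D)"
      by (auto simp: Bs_def Ds_def B_def D_def)
    moreover have "C \<in> Cs (card B)"
    proof -
      have "C = supp n \<tau> - B" by (auto simp: B_def C_def)
      then have "card C = j - card B"
        using t card_Diff_subset[of B "supp n \<tau>"] by (auto simp: B_def)
      then show ?thesis by (auto simp: Cs_def C_def supp_def)
    qed
    moreover have "\<tau> \<in> F B C D"
      using t by (auto simp: F_def B_def C_def D_def supp_def sym_grp_def)
    ultimately show "\<tau> \<in> ?U" by blast
  qed
  then have "card ?T \<le> card ?U"
    using fin finD finF by (intro card_mono finite_UN_I) auto
  also have "\<dots> \<le> (\<Sum>k\<in>K. card (\<Union>l\<in>Lk k. \<Union>B\<in>Bs k. \<Union>C\<in>Cs k. \<Union>D\<in>Ds B l. F B C D))"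
    by (rule card_UN_le[OF fin(1)])
  also have "\<dots> \<le> (\<Sum>k\<in>K. \<Sum>l\<in>Lk k. card (\<Union>B\<in>Bs k. \<Union>C\<in>Cs k. \<Union>D\<in>Ds B l. F B C D))"
    by (intro sum_mono card_UN_le fin)
  also have "\<dots> \<le> (\<Sum>k\<in>K. \<Sum>l\<in>Lk k.
      (i choose k) * ((n - i) choose (j - k)) * (k choose l) * fact (l + j - k))"
  proof (intro sum_mono)
    fix k l assume k: "k \<in> K" and "l \<in> Lk k"
    have "card (F B C D) \<le> fact (l + j - k)"
      if "B \<in> Bs k" "C \<in> Cs k" "D \<in> Ds B l" for B C D
    proof -
      have sub: "C \<subseteq> {..<n} - ?S" "D \<subseteq> ?S"
        using that by (auto simp: Bs_def Cs_def Ds_def)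
      then have "finite C" "finite D" "C \<inter> D = {}" "C \<union> D \<subseteq> {..<n}"
        by (auto simp: supp_def intro: finite_subset[of _ "{..<n}"])
      moreover have "card C = j - k" "card D = l" "k \<le> j"
        using that k by (auto simp: Cs_def Ds_def K_def)
      \<comment> \<open>As \<open>k \<le> j\<close>, the natural subtraction is exact.\<close>
      ultimately have "card (C \<union> D) = l + j - k" by (simp add: card_Un_disjoint)
      then show ?thesis
        using card_permutes_agreeing_le[of "{..<n}" "C \<union> D" "\<lambda>x. if x \<in> B then \<sigma> x else x"]
          \<open>C \<union> D \<subseteq> {..<n}\<close> by (simp only: F_def finite_lessThan)
    qed
    moreover have "card (Ds B l) = k choose l" if "B \<in> Bs k" for B
      using n_subsets[OF finB[OF that], of l] that by (simp add: Ds_def Bs_def)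
    ultimately have "card (\<Union>D\<in>Ds B l. F B C D) \<le> (k choose l) * fact (l + j - k)"
      if "B \<in> Bs k" "C \<in> Cs k" for B C
      using card_UN_le_const[of "Ds B l" "F B C" "fact (l + j - k)"] finD[OF that(1)] that by simp
    moreover have "card (Cs k) = (n - i) choose (j - k)"
    proof -
      have "card ({..<n} - ?S) = n - i"
        using card_Diff_subset[of ?S "{..<n}"] \<sigma> by (auto simp: supp_def)
      then show ?thesis using n_subsets[of "{..<n} - ?S" "j - k"] by (simp add: Cs_def)
    qed
    ultimately have "card (\<Union>C\<in>Cs k. \<Union>D\<in>Ds B l. F B C D) \<le>
        ((n - i) choose (j - k)) * ((k choose l) * fact (l + j - k))" if "B \<in> Bs k" for B
      using card_UN_le_const[of "Cs k" "\<lambda>C. \<Union>D\<in>Ds B l. F B C D" "(k choose l) * fact (l + j - k)"]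
        fin(4) that by simp
    moreover have "card (Bs k) = i choose k"
      using n_subsets[of ?S k] \<sigma> by (simp add: Bs_def)
    ultimately have "card (\<Union>B\<in>Bs k. \<Union>C\<in>Cs k. \<Union>D\<in>Ds B l. F B C D) \<le>
        (i choose k) * (((n - i) choose (j - k)) * ((k choose l) * fact (l + j - k)))"
      using card_UN_le_const[of "Bs k" "\<lambda>B. \<Union>C\<in>Cs k. \<Union>D\<in>Ds B l. F B C D"
        "((n - i) choose (j - k)) * ((k choose l) * fact (l + j - k))"] fin(3) by simp
    then show "card (\<Union>B\<in>Bs k. \<Union>C\<in>Cs k. \<Union>D\<in>Ds B l. F B C D) \<le>
        (i choose k) * ((n - i) choose (j - k)) * (k choose l) * fact (l + j - k)"
      by (simp add: mult.assoc)
  qed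
  also have "\<dots> = L n d i j" by (simp add: L_def K_def Lk_def)
  finally show ?thesis .
qed

text \<open>The term \<open>i = j = 2\<close> suffices: \<open>n choose 2\<close> is at least 3,
  \<open>derangements 2\<close> at least 1, and \<open>L n d 2 2\<close> at least 2 by its summand
  at \<open>k = 2\<close>, \<open>l = 1\<close>. The product 6 cancels the factor 1/6.\<close>

lemma E_ge_1:
  assumes "3 \<le> d" "d \<le> n"
  shows "E n d \<ge> 1"
proof -
  let ?f = "\<lambda>k l. (2 choose k) * ((n - 2) choose (2 - k)) * (k choose l) * fact (l + 2 - k)"
  let ?A = "\<lambda>k. {l. int l \<le> min (int d + 2 * int k - int 2 - int 2 - 1) (int k)}"
  have "2 = ?f 2 1" by simp
  also have "\<dots> \<le> (\<Sum>l\<in>?A 2. ?f 2 l)"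
    using assms(1) by (intro member_le_sum finite_L_index) auto
  also have "\<dots> \<le> (\<Sum>k = ceil_plus ((real 2 + real 2 - real d + 1) / 2)..min 2 2. \<Sum>l\<in>?A k. ?f k l)"
    using assms(1)
    by (intro member_le_sum[of 2 _ "\<lambda>k. \<Sum>l\<in>?A k. ?f k l"])
      (auto simp: ceil_plus_eq nat_le_iff ceiling_le_iff)
  also have "\<dots> = L n d 2 2" by (simp only: L_def)
  finally have L2: "L n d 2 2 \<ge> 2" .
  have "Transposition.transpose 0 1 \<in> {p \<in> sym_grp 2. \<forall>i<2. p i \<noteq> i}"
    by (auto simp: sym_grp_def less_2_cases_iff transpose_def intro!: permutes_swap_id)
  then have D2: "derangements 2 \<ge> 1"
    unfolding derangements_def using finite_sym_grp[of 2]
    by (metis (no_types, lifting) One_nat_def Suc_leI card_gt_0_iff empty_iff finite_Collect_conjI mem_Collect_eq finite_subset subsetI)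
  have "3 * 2 \<le> n * (n - 1)" using assms by (intro mult_le_mono) auto
  then have C2: "(n choose 2) \<ge> 3" by (simp add: choose_two)
  have "3 * 1 * 2 \<le> (n choose 2) * derangements 2 * L n d 2 2"
    using L2 D2 C2 by (intro mult_le_mono) auto
  then have "6 \<le> real (n choose 2) * real (derangements 2) * real (L n d 2 2)"
    by (simp flip: of_nat_mult)
  also have "\<dots> \<le> (\<Sum>j=2..d - 1. real (n choose 2) * real (derangements 2) * real (L n d 2 j))"
    using assms by (intro member_le_sum[of 2 "{2..d - 1}" "\<lambda>j. real (n choose 2) * real (derangements 2) * real (L n d 2 j)"]) auto
  also have "\<dots> \<le> (\<Sum>i=2..d - 1. \<Sum>j=2..d - 1. real (n choose i) * real (derangements i) * real (L n d i j))"
    using assms by (intro member_le_sum[of 2 "{2..d - 1}"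
      "\<lambda>i. \<Sum>j=2..d - 1. real (n choose i) * real (derangements i) * real (L n d i j)"] sum_nonneg) auto
  also have "\<dots> = 6 * E n d" by (simp add: E_def)
  finally show ?thesis by simp
qed

section \<open>The graph of close permutations\<close>

definition ham_adj :: "nat \<Rightarrow> nat \<Rightarrow> (nat \<Rightarrow> nat) \<Rightarrow> (nat \<Rightarrow> nat) \<Rightarrow> bool" where
  "ham_adj n d x y \<longleftrightarrow> x \<noteq> y \<and> hamming n x y < d"

interpretation ham: simple_graph "ham_adj n d" for n d
  by unfold_locales (auto simp: ham_adj_def hamming_commute)

lemma ham_indep_iff: "C \<in> ham.indep n d (sym_grp n) \<longleftrightarrow> perm_array n d C"
  by (auto simp: ham.indep_def perm_array_def ham_adj_def not_less)

lemma card_le_P: "perm_array n d C \<Longrightarrow> card C \<le> P n d"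
  unfolding P_def using finite_perm_arrays by (intro Max_ge) auto

section \<open>Left translations as automorphisms of the graph\<close>

lemma ham_adj_comp_left:
  "v permutes U \<Longrightarrow> ham_adj n d (v \<circ> x) (v \<circ> y) \<longleftrightarrow> ham_adj n d x y"
  using hamming_comp_left[of v n x y] inj_compose[of v]
  by (auto simp: ham_adj_def permutes_inj fun_eq_iff inj_eq)

text \<open>Composition with \<open>v\<close> on the left preserves adjacency and takes
  \<open>id\<close> to \<open>v\<close>, so it suffices to study the neighbourhood of
  \<open>id\<close>.\<close>

lemma bij_betw_nbhd_translate:
  assumes v: "v \<in> sym_grp n"
  shows "bij_betw (\<lambda>x. v \<circ> x) (ham.nbhd n d (sym_grp n) id) (ham.nbhd n d (sym_grp n) v)"
proof -
  have vp: "v permutes {..<n}" using v by (simp add: sym_grp_def)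
  have inv: "inv v \<circ> (v \<circ> x) = x" "v \<circ> (inv v \<circ> x) = x" for x
    by (simp_all add: permutes_inv_o[OF vp] comp_assoc[symmetric])
  have adj: "ham_adj n d v (v \<circ> x) \<longleftrightarrow> ham_adj n d id x" for x
    using ham_adj_comp_left[OF vp, of n d id x] by simp
  show ?thesis
  proof (rule bij_betw_byWitness[where f' = "\<lambda>x. inv v \<circ> x"])
    show "(\<lambda>x. v \<circ> x) ` ham.nbhd n d (sym_grp n) id \<subseteq> ham.nbhd n d (sym_grp n) v"
      by (auto simp: ham.nbhd_def adj sym_grp_def intro: permutes_compose vp)
    show "(\<lambda>x. inv v \<circ> x) ` ham.nbhd n d (sym_grp n) v \<subseteq> ham.nbhd n d (sym_grp n) id"
      by (auto simp: ham.nbhd_def sym_grp_def inv adj[symmetric]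
        intro: permutes_compose permutes_inv vp)
  qed (simp_all add: inv)
qed

lemma nbhd_id: "ham.nbhd n d (sym_grp n) id = {x \<in> sym_grp n. x \<noteq> id \<and> card (supp n x) < d}"
  by (auto simp: ham.nbhd_def ham_adj_def hamming_id)

lemma card_nbhd_le:
  assumes "d > 0" "v \<in> sym_grp n"
  shows "Suc (card (ham.nbhd n d (sym_grp n) v)) \<le> V n (d - 1)"
proof -
  let ?N = "ham.nbhd n d (sym_grp n) id"
  have "Suc (card (ham.nbhd n d (sym_grp n) v)) = Suc (card ?N)"
    using bij_betw_same_card[OF bij_betw_nbhd_translate[OF assms(2)]] by simp
  also have "\<dots> = card (insert id ?N)"
    using finite_sym_grp by (simp add: nbhd_id)
  \<comment> \<open>Since \<open>d > 0\<close>, the closed neighbourhood of \<open>id\<close> is a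
    full Hamming ball.\<close>
  also have "insert id ?N = {x \<in> sym_grp n. card (supp n x) < d}"
    unfolding nbhd_id using assms(1) by (auto simp: sym_grp_def supp_def)
  also have "card \<dots> \<le> V n (d - 1)" by (rule card_ball_le[OF assms(1)])
  finally show ?thesis .
qed

lemma nbhd_pairs_translate:
  assumes v: "v \<in> sym_grp n"
  shows "(\<Sum>u\<in>ham.nbhd n d (sym_grp n) v. card (ham.nbhd n d (ham.nbhd n d (sym_grp n) v) u)) =
    (\<Sum>u\<in>ham.nbhd n d (sym_grp n) id. card (ham.nbhd n d (ham.nbhd n d (sym_grp n) id) u))"
proof -
  let ?N = "ham.nbhd n d (sym_grp n)"
  have vp: "v permutes {..<n}" using v by (simp add: sym_grp_def)
  note bij = bij_betw_nbhd_translate[OF v, of d]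
  have "card (ham.nbhd n d (?N v) (v \<circ> u)) = card (ham.nbhd n d (?N id) u)" for u
  proof -
    have "ham.nbhd n d (?N v) (v \<circ> u) = (\<lambda>x. v \<circ> x) ` ham.nbhd n d (?N id) u"
      unfolding bij_betw_imp_surj_on[OF bij, symmetric]
      by (auto simp: ham.nbhd_def ham_adj_comp_left[OF vp])
    moreover have "inj_on (\<lambda>x. v \<circ> x) (ham.nbhd n d (?N id) u)"
      by (rule inj_on_subset[OF bij_betw_imp_inj_on[OF bij]]) (auto simp: ham.nbhd_def)
    ultimately show ?thesis by (simp add: card_image)
  qed
  then show ?thesis by (subst sum.reindex_bij_betw[OF bij, symmetric]) simp
qed

text \<open>After translation to \<open>id\<close>, the neighbours \<open>u\<close> are grouped by
  the size \<open>i\<close> of their support. There are at most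
  \<open>(n choose i) * derangements i\<close> of them, each with at most \<open>L n d i j\<close>
  neighbours of support size \<open>j\<close>. The resulting double sum is the one in
  \<open>E\<close>, without the factor 1/6.\<close>

lemma nbhd_pairs_le:
  assumes v: "v \<in> sym_grp n"
  shows "real (\<Sum>u\<in>ham.nbhd n d (sym_grp n) v.
    card (ham.nbhd n d (ham.nbhd n d (sym_grp n) v) u)) \<le> 6 * E n d"
proof -
  let ?N = "ham.nbhd n d (sym_grp n) id"
  let ?J = "{2..d - 1}"
  have fin: "finite ?N" by (rule ham.finite_nbhd[OF finite_sym_grp])
  have wt: "card (supp n x) \<in> ?J" if "x \<in> ?N" for x
    using that supp_card_ge_2[of x n] by (auto simp: nbhd_id)
  have "(\<Sum>u\<in>?N. card (ham.nbhd n d ?N u)) \<le> (\<Sum>u\<in>?N. \<Sum>j\<in>?J. L n d (card (supp n u)) j)"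
  proof (rule sum_mono)
    fix u assume "u \<in> ?N"
    let ?T = "\<lambda>j. {\<tau> \<in> sym_grp n. card (supp n \<tau>) = j \<and> hamming n u \<tau> < d}"
    have finT: "finite (?T j)" for j using finite_sym_grp by simp
    have "ham.nbhd n d ?N u \<subseteq> (\<Union>j\<in>?J. ?T j)"
    proof
      fix \<tau> assume t: "\<tau> \<in> ham.nbhd n d ?N u"
      then have "\<tau> \<in> ?N" "\<tau> \<in> sym_grp n" "hamming n u \<tau> < d"
        by (auto simp: ham.nbhd_def ham_adj_def)
      then show "\<tau> \<in> (\<Union>j\<in>?J. ?T j)" using wt[of \<tau>] by blast
    qed
    then have "card (ham.nbhd n d ?N u) \<le> card (\<Union>j\<in>?J. ?T j)"
      using finT by (intro card_mono) auto
    also have "\<dots> \<le> (\<Sum>j\<in>?J. card (?T j))" by (rule card_UN_le) simp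
    also have "\<dots> \<le> (\<Sum>j\<in>?J. L n d (card (supp n u)) j)"
      by (intro sum_mono card_near_le_L refl)
    finally show "card (ham.nbhd n d ?N u) \<le> (\<Sum>j\<in>?J. L n d (card (supp n u)) j)" .
  qed
  also have "\<dots> = (\<Sum>i\<in>?J. \<Sum>u | u \<in> ?N \<and> card (supp n u) = i. \<Sum>j\<in>?J. L n d (card (supp n u)) j)"
    by (rule sum.group[OF fin, symmetric]) (use wt in auto)
  also have "\<dots> = (\<Sum>i\<in>?J. card {u \<in> ?N. card (supp n u) = i} * (\<Sum>j\<in>?J. L n d i j))"
    by (intro sum.cong refl) simp
  also have "\<dots> \<le> (\<Sum>i\<in>?J. ((n choose i) * derangements i) * (\<Sum>j\<in>?J. L n d i j))"
  proof (intro sum_mono mult_right_mono)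
    fix i
    have "card {u \<in> ?N. card (supp n u) = i} \<le> card {x \<in> sym_grp n. card (supp n x) = i}"
      using finite_sym_grp by (intro card_mono) (auto simp: nbhd_id)
    then show "card {u \<in> ?N. card (supp n u) = i} \<le> (n choose i) * derangements i"
      using card_weight_le le_trans by blast
  qed simp
  finally have "(\<Sum>u\<in>?N. card (ham.nbhd n d ?N u)) \<le>
      (\<Sum>i\<in>?J. ((n choose i) * derangements i) * (\<Sum>j\<in>?J. L n d i j))" .
  then have "real (\<Sum>u\<in>?N. card (ham.nbhd n d ?N u)) \<le>
      real (\<Sum>i\<in>?J. ((n choose i) * derangements i) * (\<Sum>j\<in>?J. L n d i j))"
    by (rule of_nat_mono)
  also have "\<dots> = 6 * E n d"
    by (simp add: E_def sum_distrib_left)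
  finally show ?thesis unfolding nbhd_pairs_translate[OF v] .
qed

theorem theorem1:
  fixes n d :: nat
  assumes "1 \<le> d" and "d \<le> n"
  shows "real (P n d) \<ge>
    fact n / (10 * real (V n (d - 1))) *
      (log 2 (real (V n (d - 1))) - 1 / 2 * log 2 (E n d))"
proof (cases "d \<ge> 3")
  \<comment> \<open>From \<open>d = 3\<close> on, \<open>E n d \<ge> 1\<close>, as the bound for
    locally sparse graphs requires.\<close>
  case True
  have card: "card (sym_grp n) = fact n"
    unfolding sym_grp_def by (rule card_permutations) auto
  have "id \<in> sym_grp n" by (simp add: sym_grp_def)
  with card_nbhd_le[of d id n] assms(1) have "V n (d - 1) > 0" by simp
  then obtain I where I: "I \<in> ham.indep n d (sym_grp n)"
    "real (card (sym_grp n)) / (10 * real (V n (d - 1))) *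
      (log 2 (real (V n (d - 1))) - 1 / 2 * log 2 (E n d)) \<le> real (card I)"
    using ham.locally_sparse_indep[OF finite_sym_grp E_ge_1[OF True assms(2)]]
      card_nbhd_le nbhd_pairs_le assms(1) by (metis One_nat_def Suc_le_eq)
  moreover have "card I \<le> P n d"
    using I(1) by (intro card_le_P) (simp add: ham_indep_iff)
  ultimately show ?thesis by (simp add: card)
next
  case False
  \<comment> \<open>Here \<open>E n d = 0\<close>, whose logarithm is \<open>0\<close> in HOL, and \<open>V n (d - 1) = 1\<close>.\<close>
  have D1: "derangements 1 = 0"
    by (simp add: derangements_def sym_grp_def lessThan_Suc)
  have "d = 1 \<or> d = 2" using False assms(1) by linarith
  then have "E n d = 0" "V n (d - 1) = 1"
    using D1 by (auto simp: E_def V_def derangements_0)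
  then show ?thesis by (simp add: log_def)
qed

end
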